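(* Let $\alpha\in(0,1)$, let $\theta^*\in\Theta$, and let $X_1,\dots,X_{2n}$ be independent and identically distributed with distribution $\mathcal P_{\theta^*}$, i.e. with PDF $p(x;\theta^* )$. Define the set estimators $$C_n^{\alpha}=\{\theta\in\Theta: U^{0}_{\boldsymbol\alpha,\boldsymbol\beta,n}(\theta)\le 1/\alpha\},\qquad \bar C_n^{\alpha}=\{\theta\in\Theta: \bar U_{\boldsymbol\alpha,\boldsymbol\beta,n}(\theta)\le 1/\alpha\},$$ where $U^{0}_{\boldsymbol\alpha,\boldsymbol\beta,n}$ and $\bar U_{\boldsymbol\alpha,\boldsymbol\beta,n}$ are the split and swapped composite likelihood ratio statistics. Then $C_n^\alpha$ and $\bar C_n^\alpha$ are finite-sample valid $100(1-\alpha)\%$ confidence sets for $\theta^*$; that is, for every $n\in\mathbb N$, $$\mathrm{Pr}_{\theta^*}(\theta^*\in C_n^{\alpha})\ge 1-\alpha\quad\text{and}\quad \mathrm{Pr}_{\theta^*}(\theta^*\in\bar C_n^{\alpha})\ge 1-\alpha .$$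
   Context: Model. $d,q\in\mathbb N$, $\mathbb X\subseteq\mathbb R^d$, $\Theta\subseteq\mathbb R^q$. $\{\mathcal P_\theta:\theta\in\Theta\}$ is a parametric family of distributions on $\mathbb X$ with probability density or mass functions $p(x;\theta)$ ("PDF" means PDF or PMF throughout). $\mathrm{Pr}_{\theta^*}$ is probability when the data are i.i.d. from $\mathcal P_{\theta^*}$. Index sets. $[d]=\{1,\dots,d\}$; $\mathbb S_d$ is the set of all non-empty subsets of $[d]$; $\mathbb T_d$ is the set of all ordered pairs $T=(\overleftarrow T,\overrightarrow T)$ of disjoint non-empty subsets of $[d]$ (their union need not be $[d]$; so $|\mathbb T_d|=3^d-2^{d+1}+1$). For $x\in\mathbb R^d$ and $S\subseteq[d]$, $x_S$ is the subvector of coordinates indexed by $S$. $p(x_S;\theta)$ denotes the marginal PDF of $X_S$ and $p(x_{\overleftarrow T}\mid x_{\overrightarrow T};\theta)$ the conditional PDF of $X_{\overleftarrow T}$ given $X_{\overrightarrow T}=x_{\overrightarrow T}$ when $X\sim\mathcal P_\theta$ (a fixed version, which is a PDF in $x_{\overleftarrow T}$ for each $x_{\overrightarrow T}$). Composite likelihood. Fixed weights $\alpha_S\ge0$ ($S\in\mathbb S_d$), $\beta_T\ge0$ ($T\in\mathbb T_d$), collected in $\boldsymbol\alpha=(\alpha_S)_{S}$, $\boldsymbol\beta=(\beta_T)_{T}$, satisfy $\gamma=\sum_{S\in\mathbb S_d}\alpha_S+\sum_{T\in\mathbb T_d}\beta_T>0$. The individual composite likelihood is $$p_{\boldsymbol\alpha,\boldsymbol\beta}(x;\theta)=\prod_{S\in\mathbb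 S_d}[p(x_S;\theta)]^{\alpha_S/\gamma}\prod_{T\in\mathbb T_d}[p(x_{\overleftarrow T}\mid x_{\overrightarrow T};\theta)]^{\beta_T/\gamma}$$ (with $0^0=1$). The weights are unrelated to the scalar level $\alpha$. Split data and statistics. The sample $X_1,\dots,X_{2n}$ is split into $\mathbf X_n^0=(X_1,\dots,X_n)=(X_1^0,\dots,X_n^0)$ and $\mathbf X_n^1=(X_{n+1},\dots,X_{2n})=(X_1^1,\dots,X_n^1)$. For $k\in\{0,1\}$, $\tilde\theta_n^k$ is an arbitrary $\Theta$-valued estimator (measurable function) of the data $\mathbf X_n^k$ only. Put $L_{\boldsymbol\alpha,\boldsymbol\beta}(\theta;\mathbf X_n^k)=\prod_{i=1}^n p_{\boldsymbol\alpha,\boldsymbol\beta}(X_i^k;\theta)$, $$U^k_{\boldsymbol\alpha,\boldsymbol\beta,n}(\theta)=\frac{L_{\boldsymbol\alpha,\boldsymbol\beta}(\tilde\theta_n^{1-k};\mathbf X_n^k)}{L_{\boldsymbol\alpha,\boldsymbol\beta}(\theta;\mathbf X_n^k)},\qquad \bar U_{\boldsymbol\alpha,\boldsymbol\beta,n}(\theta)=\frac{U^0_{\boldsymbol\alpha,\boldsymbol\beta,n}(\theta)+U^1_{\boldsymbol\alpha,\boldsymbol\beta,n}(\theta)}{2}.$$ *)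

theory Defs
  imports "HOL-Probability.Probability"
begin

text \<open>
  Points of R^d have type \<^typ>\<open>real ^ 'd\<close>, so the coordinate set [d] is the finite type 'd.
  A subvector is a function that is extensional on its index set, i.e. an element of
  \<open>PiE S (\<lambda>_. UNIV)\<close>.
\<close>

definition subvec :: "real ^ 'd \<Rightarrow> 'd set \<Rightarrow> 'd \<Rightarrow> real" where
  "subvec x S = (\<lambda>i\<in>S. x $ i)"

abbreviation subvec_space :: "'d set \<Rightarrow> ('d \<Rightarrow> real) measure" where
  "subvec_space S \<equiv> (\<Pi>\<^sub>M i\<in>S. (borel :: real measure))"

abbreviation sample_space :: "(real ^ 'd) set \<Rightarrow> (real ^ 'd) measure" where
  "sample_space \<X> \<equiv> restrict_space borel \<X>"

definition index_sets :: "'d set set" where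
  "index_sets = {S. S \<noteq> {}}"

definition index_pairs :: "('d set \<times> 'd set) set" where
  "index_pairs = {(A, B). A \<noteq> {} \<and> B \<noteq> {} \<and> A \<inter> B = {}}"

text \<open>
  A family has either Lebesgue densities or probability mass functions; the two cases differ only
  in the reference measure on the subvectors. In the discrete case no common countable support is
  assumed; each single mass function has countable support because it sums to 1.
\<close>

datatype pdf_kind = Density | Mass

primrec ref_measure :: "pdf_kind \<Rightarrow> 'd set \<Rightarrow> ('d \<Rightarrow> real) measure" where
  "ref_measure Density S = (\<Pi>\<^sub>M i\<in>S. lborel)"
| "ref_measure Mass S = count_space (\<Pi>\<^sub>E i\<in>S. UNIV)"

definition is_pdf :: "pdf_kind \<Rightarrow> 'd set \<Rightarrow> (('d \<Rightarrow> real) \<Rightarrow> real) \<Rightarrow> bool" where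
  "is_pdf K S f \<longleftrightarrow>
     f \<in> borel_measurable (subvec_space S) \<and>
     (\<forall>y\<in>space (subvec_space S). 0 \<le> f y) \<and>
     (\<integral>\<^sup>+ y. ennreal (f y) \<partial>ref_measure K S) = 1"

text \<open>
  \<open>f\<close> is a version of the PDF of the subvector of X indexed by S when X has distribution P. For
  \<open>S = UNIV\<close> this is the joint PDF. Equality of \<open>distr\<close> and \<open>density\<close> would be too strong in the
  discrete case, where the counting measure lives on the power set.
\<close>

definition is_marginal_pdf ::
    "pdf_kind \<Rightarrow> (real ^ 'd) measure \<Rightarrow> 'd set \<Rightarrow> (('d \<Rightarrow> real) \<Rightarrow> real) \<Rightarrow> bool" where
  "is_marginal_pdf K P S f \<longleftrightarrow>
     is_pdf K S f \<and>
     (\<forall>E\<in>sets (subvec_space S).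
        emeasure P {x\<in>space P. subvec x S \<in> E} =
        (\<integral>\<^sup>+ y. ennreal (f y) * indicator E y \<partial>ref_measure K S))"

text \<open>
  \<open>g a b\<close> is a version of the conditional PDF at \<open>a\<close> of the subvector indexed by A, given that the
  subvector indexed by B equals \<open>b\<close>: it is a PDF in \<open>a\<close> for every \<open>b\<close>, and the kernel it defines
  is a regular conditional distribution.
\<close>

definition is_conditional_pdf ::
    "pdf_kind \<Rightarrow> (real ^ 'd) measure \<Rightarrow> 'd set \<Rightarrow> 'd set \<Rightarrow>
     (('d \<Rightarrow> real) \<Rightarrow> ('d \<Rightarrow> real) \<Rightarrow> real) \<Rightarrow> bool" where
  "is_conditional_pdf K P A B g \<longleftrightarrow>
     (\<lambda>(y, z). g y z) \<in> borel_measurable (subvec_space A \<Otimes>\<^sub>M subvec_space B) \<and>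
     (\<forall>z\<in>space (subvec_space B). is_pdf K A (\<lambda>y. g y z)) \<and>
     (\<forall>E\<in>sets (subvec_space A). \<forall>F\<in>sets (subvec_space B).
        emeasure P {x\<in>space P. subvec x A \<in> E \<and> subvec x B \<in> F} =
        (\<integral>\<^sup>+ x. indicator F (subvec x B) *
            (\<integral>\<^sup>+ y. ennreal (g y (subvec x B)) * indicator E y \<partial>ref_measure K A) \<partial>P))"

text \<open>\<open>0 powr 0 = 0\<close> in the library, while composite likelihoods need the convention 0^0 = 1.\<close>

definition rpow :: "real \<Rightarrow> real \<Rightarrow> real" where
  "rpow x w = (if w = 0 then 1 else x powr w)"

definition total_weight :: "('d::finite set \<Rightarrow> real) \<Rightarrow> ('d set \<times> 'd set \<Rightarrow> real) \<Rightarrow> real" where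
  "total_weight a b = (\<Sum>S\<in>index_sets. a S) + (\<Sum>T\<in>index_pairs. b T)"

text \<open>
  In what follows \<open>a\<close> and \<open>b\<close> are the weights, \<open>p \<theta> S\<close> is the marginal PDF for the index set S, and
  \<open>c \<theta> (A, B)\<close> is the conditional PDF of the A-subvector given the B-subvector.
\<close>

definition comp_pdf ::
    "('d::finite set \<Rightarrow> real) \<Rightarrow> ('d set \<times> 'd set \<Rightarrow> real) \<Rightarrow>
     ('t \<Rightarrow> 'd set \<Rightarrow> ('d \<Rightarrow> real) \<Rightarrow> real) \<Rightarrow>
     ('t \<Rightarrow> 'd set \<times> 'd set \<Rightarrow> ('d \<Rightarrow> real) \<Rightarrow> ('d \<Rightarrow> real) \<Rightarrow> real) \<Rightarrow>
     't \<Rightarrow> real ^ 'd \<Rightarrow> real" where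
  "comp_pdf a b p c \<theta> x =
     (\<Prod>S\<in>index_sets. rpow (p \<theta> S (subvec x S)) (a S / total_weight a b)) *
     (\<Prod>T\<in>index_pairs. rpow (c \<theta> T (subvec x (fst T)) (subvec x (snd T)))
                              (b T / total_weight a b))"

definition comp_lik ::
    "('d::finite set \<Rightarrow> real) \<Rightarrow> ('d set \<times> 'd set \<Rightarrow> real) \<Rightarrow>
     ('t \<Rightarrow> 'd set \<Rightarrow> ('d \<Rightarrow> real) \<Rightarrow> real) \<Rightarrow>
     ('t \<Rightarrow> 'd set \<times> 'd set \<Rightarrow> ('d \<Rightarrow> real) \<Rightarrow> ('d \<Rightarrow> real) \<Rightarrow> real) \<Rightarrow>
     nat \<Rightarrow> 't \<Rightarrow> (nat \<Rightarrow> real ^ 'd) \<Rightarrow> real" where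
  "comp_lik a b p c n \<theta> xs = (\<Prod>i=1..n. comp_pdf a b p c \<theta> (xs i))"

text \<open>
  A sample of size 2n is a function that is extensional on \<open>{1..2 * n}\<close>; for k = 0, 1, its k-th half
  is re-indexed by \<open>{1..n}\<close>.
\<close>

definition half_sample :: "nat \<Rightarrow> nat \<Rightarrow> (nat \<Rightarrow> 'x) \<Rightarrow> nat \<Rightarrow> 'x" where
  "half_sample n k xs = (\<lambda>i\<in>{1..n}. xs (k * n + i))"

text \<open>
  The ratio is taken in \<^typ>\<open>ennreal\<close>, so that it is infinite, rather than 0, if only the denominator
  vanishes; \<open>0 / 0 = 0\<close> there. Either way, the denominator at the true parameter vanishes with
  probability 0 only. Since the plugged-in estimator varies with the data, measurability of
  \<open>p \<theta> S\<close> and \<open>c \<theta> T\<close> for each fixed \<open>\<theta>\<close> does not make the ratio a measurable function of the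
  sample; measurability jointly in \<open>\<theta>\<close> and the subvectors does.
\<close>

definition split_stat ::
    "('d::finite set \<Rightarrow> real) \<Rightarrow> ('d set \<times> 'd set \<Rightarrow> real) \<Rightarrow>
     ('t \<Rightarrow> 'd set \<Rightarrow> ('d \<Rightarrow> real) \<Rightarrow> real) \<Rightarrow>
     ('t \<Rightarrow> 'd set \<times> 'd set \<Rightarrow> ('d \<Rightarrow> real) \<Rightarrow> ('d \<Rightarrow> real) \<Rightarrow> real) \<Rightarrow>
     nat \<Rightarrow> (nat \<Rightarrow> (nat \<Rightarrow> real ^ 'd) \<Rightarrow> 't) \<Rightarrow> nat \<Rightarrow> 't \<Rightarrow> (nat \<Rightarrow> real ^ 'd) \<Rightarrow> ennreal" where
  "split_stat a b p c n est k \<theta> xs =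
     ennreal (comp_lik a b p c n (est (1 - k) (half_sample n (1 - k) xs)) (half_sample n k xs)) /
     ennreal (comp_lik a b p c n \<theta> (half_sample n k xs))"

definition swapped_stat ::
    "('d::finite set \<Rightarrow> real) \<Rightarrow> ('d set \<times> 'd set \<Rightarrow> real) \<Rightarrow>
     ('t \<Rightarrow> 'd set \<Rightarrow> ('d \<Rightarrow> real) \<Rightarrow> real) \<Rightarrow>
     ('t \<Rightarrow> 'd set \<times> 'd set \<Rightarrow> ('d \<Rightarrow> real) \<Rightarrow> ('d \<Rightarrow> real) \<Rightarrow> real) \<Rightarrow>
     nat \<Rightarrow> (nat \<Rightarrow> (nat \<Rightarrow> real ^ 'd) \<Rightarrow> 't) \<Rightarrow> 't \<Rightarrow> (nat \<Rightarrow> real ^ 'd) \<Rightarrow> ennreal" where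
  "swapped_stat a b p c n est \<theta> xs =
     (split_stat a b p c n est 0 \<theta> xs + split_stat a b p c n est 1 \<theta> xs) / 2"

definition split_conf_set ::
    "('d::finite set \<Rightarrow> real) \<Rightarrow> ('d set \<times> 'd set \<Rightarrow> real) \<Rightarrow>
     ('t \<Rightarrow> 'd set \<Rightarrow> ('d \<Rightarrow> real) \<Rightarrow> real) \<Rightarrow>
     ('t \<Rightarrow> 'd set \<times> 'd set \<Rightarrow> ('d \<Rightarrow> real) \<Rightarrow> ('d \<Rightarrow> real) \<Rightarrow> real) \<Rightarrow>
     nat \<Rightarrow> (nat \<Rightarrow> (nat \<Rightarrow> real ^ 'd) \<Rightarrow> 't) \<Rightarrow> 't set \<Rightarrow> real \<Rightarrow> (nat \<Rightarrow> real ^ 'd) \<Rightarrow> 't set" where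
  "split_conf_set a b p c n est \<Theta> \<alpha> xs =
     {\<theta>\<in>\<Theta>. split_stat a b p c n est 0 \<theta> xs \<le> ennreal (1 / \<alpha>)}"

definition swapped_conf_set ::
    "('d::finite set \<Rightarrow> real) \<Rightarrow> ('d set \<times> 'd set \<Rightarrow> real) \<Rightarrow>
     ('t \<Rightarrow> 'd set \<Rightarrow> ('d \<Rightarrow> real) \<Rightarrow> real) \<Rightarrow>
     ('t \<Rightarrow> 'd set \<times> 'd set \<Rightarrow> ('d \<Rightarrow> real) \<Rightarrow> ('d \<Rightarrow> real) \<Rightarrow> real) \<Rightarrow>
     nat \<Rightarrow> (nat \<Rightarrow> (nat \<Rightarrow> real ^ 'd) \<Rightarrow> 't) \<Rightarrow> 't set \<Rightarrow> real \<Rightarrow> (nat \<Rightarrow> real ^ 'd) \<Rightarrow> 't set" where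
  "swapped_conf_set a b p c n est \<Theta> \<alpha> xs =
     {\<theta>\<in>\<Theta>. swapped_stat a b p c n est \<theta> xs \<le> ennreal (1 / \<alpha>)}"

end

theory Submission
  imports Defs
begin

text \<open>Cancelling a denominator against the data density loses whatever mass the numerator has
  where that density vanishes; hence means at most 1 rather than equal to 1. The main work lies in
  the conditional PDFs. Their ratio depends jointly on both subvectors, while the defining property
  of a conditional PDF speaks of rectangles only, so a disintegration formula for general jointly
  measurable integrands has to be established. In the discrete case its inner integral runs over a
  counting measure that is not sigma-finite, and measurability has to come from the countable
  support of the data distribution instead. Finally, the PDFs are measurable only for each fixed
  parameter. Measurability of the statistic at the true parameter is therefore a hypothesis, and
  Fubini is applied to the statistic as a whole, so that composite PDFs are integrated only after
  the estimate has been frozen.\<close>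

text \<open>
  By weighted AM-GM, the ratio of composite PDFs at \<open>\<theta>\<close> and \<open>\<theta>'\<close> is at most the weighted average of the
  ratios of the marginal and conditional PDFs. When the data come from \<open>\<theta>'\<close>, each of these ratios has
  mean at most 1, hence so has the composite ratio. The plugged-in estimator is fixed
  once the other half of the sample is, so independence and Fubini give mean at most 1 for both split
  statistics and for their average. Markov's inequality concludes.
\<close>

section \<open>Ratios of products in the extended nonnegative reals, and weighted AM-GM\<close>

lemma rpow_nonneg: "0 \<le> rpow x w"
  by (simp add: rpow_def)

text \<open>A vanishing numerator makes the left side 0. Otherwise no factor on the right is 0, so a
  single vanishing denominator makes the right side infinite. With all values positive both sides
  agree. This splits the likelihood ratio of a sample into one factor per observation.\<close>

lemma ennreal_prod_divide_le:
  fixes f g :: "'i \<Rightarrow> real"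
  assumes "finite I" "\<And>i. i \<in> I \<Longrightarrow> 0 \<le> f i" "\<And>i. i \<in> I \<Longrightarrow> 0 \<le> g i"
  shows "ennreal (\<Prod>i\<in>I. f i) / ennreal (\<Prod>i\<in>I. g i) \<le> (\<Prod>i\<in>I. ennreal (f i) / ennreal (g i))"
proof (cases "\<exists>i\<in>I. f i = 0")
  case True
  then have "(\<Prod>i\<in>I. f i) = 0" using assms(1) by auto
  then show ?thesis by simp
next
  case False
  then have f: "0 < f i" if "i \<in> I" for i using assms(2)[OF that] that by force
  show ?thesis
  proof (cases "\<exists>i\<in>I. g i = 0")
    case True
    then have "(\<Prod>i\<in>I. ennreal (f i) / ennreal (g i)) = top"
      using f assms(1) by (force simp: ennreal_prod_eq_top ennreal_divide_eq_top_iff ennreal_eq_0_iff not_le)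
    then show ?thesis by simp
  next
    case False
    then have g: "0 < g i" if "i \<in> I" for i using assms(3)[OF that] that by force
    show ?thesis
      using f g by (simp add: divide_ennreal prod_nonneg prod_pos less_imp_le prod_ennreal prod_dividef)
  qed
qed

text \<open>Jensen's inequality for \<open>exp\<close> at the points \<open>ln (x i)\<close>; strict
  positivity gives \<open>x i = exp (ln (x i))\<close>.\<close>

lemma weighted_arith_geom_mean:
  fixes w x :: "'i \<Rightarrow> real"
  assumes "finite I" "\<And>i. i \<in> I \<Longrightarrow> 0 \<le> w i" "(\<Sum>i\<in>I. w i) = 1" "\<And>i. i \<in> I \<Longrightarrow> 0 < x i"
  shows "(\<Prod>i\<in>I. x i powr w i) \<le> (\<Sum>i\<in>I. w i * x i)"
proof -
  have "I \<noteq> {}" using assms(3) by auto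
  have "(\<Prod>i\<in>I. x i powr w i) = exp (\<Sum>i\<in>I. w i *\<^sub>R ln (x i))"
    using assms(1,4) by (simp add: exp_sum powr_def less_imp_neq[symmetric])
  also have "\<dots> \<le> (\<Sum>i\<in>I. w i * exp (ln (x i)))"
    using assms \<open>I \<noteq> {}\<close> by (intro convex_on_sum[OF _ _ exp_convex]) auto
  finally show ?thesis using assms(4) by simp
qed

text \<open>
  No positivity of \<open>g\<close> is required: in \<^typ>\<open>ennreal\<close>, a zero of \<open>g\<close> of positive weight makes the
  right-hand side infinite unless \<open>f\<close> vanishes there too, and then the left-hand side is 0.
\<close>

lemma ennreal_prod_rpow_divide_le:
  fixes w f g :: "'i \<Rightarrow> real"
  assumes I: "finite I" and w: "\<And>i. i \<in> I \<Longrightarrow> 0 \<le> w i" "(\<Sum>i\<in>I. w i) = 1"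
    and f: "\<And>i. i \<in> I \<Longrightarrow> 0 \<le> f i" and g: "\<And>i. i \<in> I \<Longrightarrow> 0 \<le> g i"
  shows "ennreal (\<Prod>i\<in>I. rpow (f i) (w i)) / ennreal (\<Prod>i\<in>I. rpow (g i) (w i))
           \<le> (\<Sum>i\<in>I. ennreal (w i) * (ennreal (f i) / ennreal (g i)))"
proof -
  \<comment> \<open>An index of weight 0 contributes the factor 1 on the left whatever
    \<open>f\<close> and \<open>g\<close> are there, by the convention built into
    \<open>rpow\<close>. Only zeros at indices of positive weight may enter the case distinctions
    below, and on \<open>J\<close> the function \<open>rpow\<close> is plain
    \<open>powr\<close>.\<close>
  define J where "J = {i \<in> I. w i \<noteq> 0}"
  have J: "finite J" "J \<subseteq> I" using I by (auto simp: J_def)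
  have wJ: "0 < w i" if "i \<in> J" for i using w(1)[of i] that by (auto simp: J_def)
  have sumJ: "(\<Sum>i\<in>J. w i) = 1"
    using w(2) I by (subst sum.mono_neutral_left[of I J w]) (auto simp: J_def)
  have prodJ: "(\<Prod>i\<in>I. rpow (h i) (w i)) = (\<Prod>i\<in>J. h i powr w i)" for h
    using I by (intro prod.mono_neutral_cong_right) (auto simp: J_def rpow_def)
  have sum_le: "(\<Sum>i\<in>J. ennreal (w i) * (ennreal (f i) / ennreal (g i)))
      \<le> (\<Sum>i\<in>I. ennreal (w i) * (ennreal (f i) / ennreal (g i)))"
    using I J by (intro sum_mono2) auto
  show ?thesis
  proof (cases "\<exists>i\<in>J. f i = 0")
    case True
    then have "(\<Prod>i\<in>I. rpow (f i) (w i)) = 0" unfolding prodJ using J by auto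
    then show ?thesis by simp
  next
    case False
    then have fJ: "0 < f i" if "i \<in> J" for i using f[of i] that J by force
    show ?thesis
    proof (cases "\<exists>i\<in>J. g i = 0")
      case True
      then obtain i where i: "i \<in> J" "g i = 0" by auto
      then have "ennreal (w i) * (ennreal (f i) / ennreal (g i)) = top"
        using fJ wJ by (simp add: ennreal_mult_top ennreal_eq_0_iff not_le)
      moreover have "ennreal (w i) * (ennreal (f i) / ennreal (g i))
          \<le> (\<Sum>i\<in>I. ennreal (w i) * (ennreal (f i) / ennreal (g i)))"
        using i J I by (intro member_le_sum) auto
      ultimately show ?thesis by (simp add: top_unique)
    next
      case False
      then have gJ: "0 < g i" if "i \<in> J" for i using g[of i] that J by force
      have "ennreal (\<Prod>i\<in>I. rpow (f i) (w i)) / ennreal (\<Prod>i\<in>I. rpow (g i) (w i))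
          = ennreal (\<Prod>i\<in>J. (f i / g i) powr w i)"
        unfolding prodJ using fJ gJ
        by (subst divide_ennreal)
           (auto intro!: prod_nonneg prod_pos simp: powr_divide less_imp_le prod_dividef less_imp_neq[symmetric])
      also have "\<dots> \<le> ennreal (\<Sum>i\<in>J. w i * (f i / g i))"
        using J wJ sumJ fJ gJ by (intro ennreal_leI weighted_arith_geom_mean) (auto simp: less_imp_le)
      also have "\<dots> = (\<Sum>i\<in>J. ennreal (w i) * (ennreal (f i) / ennreal (g i)))"
        using fJ gJ wJ by (simp add: less_imp_le divide_ennreal flip: ennreal_mult sum_ennreal)
      also note sum_le
      finally show ?thesis .
    qed
  qed
qed

section \<open>Subvectors, reference measures and marginal PDFs\<close>

lemma space_ref_measure: "space (ref_measure K S) = space (subvec_space S)"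
  by (cases K) (auto simp: space_PiM)

text \<open>The sigma-algebra of \<open>ref_measure\<close> is that of \<open>subvec_space\<close>
  for densities and the full power set for mass functions, hence never coarser. The identity map
  carries measurability over in both cases at once, so later arguments need not split on
  \<open>K\<close>.\<close>

lemma measurable_ident_ref_measure: "(\<lambda>y. y) \<in> ref_measure K S \<rightarrow>\<^sub>M subvec_space S"
proof (cases K)
  case Density
  have "sets (ref_measure K S) = sets (subvec_space S)"
    unfolding Density ref_measure.simps by (intro sets_PiM_cong) auto
  then show ?thesis by (simp add: measurable_ident_sets)
next
  case Mass
  then show ?thesis by (auto simp: space_PiM)
qed

lemma measurable_ref_measureI:
  "f \<in> subvec_space S \<rightarrow>\<^sub>M N \<Longrightarrow> f \<in> ref_measure K S \<rightarrow>\<^sub>M N"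
  by (rule measurable_compose[OF measurable_ident_ref_measure])

lemma subvec_in_space: "subvec x S \<in> space (subvec_space S)"
  by (auto simp: subvec_def space_PiM)

lemma measurable_subvec:
  fixes P :: "(real ^ 'd::finite) measure"
  assumes "sets P = sets (sample_space \<X>)"
  shows "(\<lambda>x. subvec x S) \<in> P \<rightarrow>\<^sub>M subvec_space S"
  unfolding subvec_def measurable_cong_sets[OF assms refl]
  by (intro measurable_restrict_space1 measurable_restrict) auto

lemma is_pdf_nonneg: "is_pdf K S f \<Longrightarrow> y \<in> space (subvec_space S) \<Longrightarrow> 0 \<le> f y"
  by (auto simp: is_pdf_def)

lemma is_pdf_measurable: "is_pdf K S f \<Longrightarrow> f \<in> borel_measurable (subvec_space S)"
  by (auto simp: is_pdf_def)

lemma is_pdf_nn_integral: "is_pdf K S f \<Longrightarrow> (\<integral>\<^sup>+ y. ennreal (f y) \<partial>ref_measure K S) = 1"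
  by (auto simp: is_pdf_def)

text \<open>Pointwise the integrand is at most \<open>f\<close>: the factors cancel where
  \<open>g\<close> is positive, and elsewhere the product is 0. The integral of \<open>f\<close>
  over the zeros of \<open>g\<close> is what is lost.\<close>

lemma nn_integral_times_divide_is_pdf_le:
  assumes "is_pdf K S f"
  shows "(\<integral>\<^sup>+ y. ennreal (g y) * (ennreal (f y) / ennreal (g y)) \<partial>ref_measure K S) \<le> 1"
proof -
  have "(\<integral>\<^sup>+ y. ennreal (g y) * (ennreal (f y) / ennreal (g y)) \<partial>ref_measure K S)
      \<le> (\<integral>\<^sup>+ y. ennreal (f y) \<partial>ref_measure K S)"
  proof (rule nn_integral_mono)
    fix y
    show "ennreal (g y) * (ennreal (f y) / ennreal (g y)) \<le> ennreal (f y)"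
      by (cases "ennreal (g y) = 0")
         (simp_all add: ennreal_times_divide ennreal_mult_divide_eq mult.commute)
  qed
  then show ?thesis using is_pdf_nn_integral[OF assms] by simp
qed

text \<open>The law of the subvector and the density \<open>?D\<close> may live on different
  sigma-algebras. Pushing \<open>?D\<close> forward along the identity restricts it to the sets of
  \<open>subvec_space\<close>, where \<open>is_marginal_pdf\<close> says that the two measures
  agree; equality of integrals follows.\<close>

lemma nn_integral_marginal_pdf:
  fixes P :: "(real ^ 'd::finite) measure"
  assumes P: "sets P = sets (sample_space \<X>)" and p: "is_marginal_pdf K P S p"
    and h: "h \<in> borel_measurable (subvec_space S)"
  shows "(\<integral>\<^sup>+ x. h (subvec x S) \<partial>P) = (\<integral>\<^sup>+ y. ennreal (p y) * h y \<partial>ref_measure K S)"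
proof -
  note [measurable] = measurable_subvec[OF P]
  have pdf: "is_pdf K S p" using p by (simp add: is_marginal_pdf_def)
  have pm: "p \<in> borel_measurable (ref_measure K S)"
    using is_pdf_measurable[OF pdf] by (rule measurable_ref_measureI)
  note id = measurable_ident_ref_measure[of K S]
  let ?D = "density (ref_measure K S) (\<lambda>y. ennreal (p y))"
  have idD: "(\<lambda>y. y) \<in> ?D \<rightarrow>\<^sub>M subvec_space S" using id by simp
  have "distr P (subvec_space S) (\<lambda>x. subvec x S) = distr ?D (subvec_space S) (\<lambda>y. y)"
  proof (rule measure_eqI)
    fix E assume "E \<in> sets (distr P (subvec_space S) (\<lambda>x. subvec x S))"
    then have E: "E \<in> sets (subvec_space S)" by simp
    have E': "E \<in> sets (ref_measure K S)"
      using measurable_sets[OF id E] sets.sets_into_space[OF E] by (simp add: space_ref_measure Int_absorb2)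
    have "emeasure (distr P (subvec_space S) (\<lambda>x. subvec x S)) E = emeasure P {x \<in> space P. subvec x S \<in> E}"
      using E by (subst emeasure_distr) (auto intro!: arg_cong[where f="emeasure P"])
    also have "\<dots> = (\<integral>\<^sup>+ y. ennreal (p y) * indicator E y \<partial>ref_measure K S)"
      using p E by (simp add: is_marginal_pdf_def)
    also have "\<dots> = emeasure ?D E"
      using E' pm by (simp add: emeasure_density)
    also have "\<dots> = emeasure (distr ?D (subvec_space S) (\<lambda>y. y)) E"
      using E sets.sets_into_space[OF E]
      by (subst emeasure_distr[OF idD]) (auto simp: space_ref_measure Int_absorb2)
    finally show "emeasure (distr P (subvec_space S) (\<lambda>x. subvec x S)) E
      = emeasure (distr ?D (subvec_space S) (\<lambda>y. y)) E" .
  qed simp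
  then have "(\<integral>\<^sup>+ x. h (subvec x S) \<partial>P) = (\<integral>\<^sup>+ y. h y \<partial>distr ?D (subvec_space S) (\<lambda>y. y))"
    using nn_integral_distr[OF measurable_subvec[OF P], of h S] h by simp
  also have "\<dots> = (\<integral>\<^sup>+ y. h y \<partial>?D)"
    using h by (intro nn_integral_distr[OF idD]) auto
  also have "\<dots> = (\<integral>\<^sup>+ y. ennreal (p y) * h y \<partial>ref_measure K S)"
    using pm measurable_ref_measureI[OF h] by (intro nn_integral_density) auto
  finally show ?thesis .
qed

lemma nn_integral_marginal_ratio_le:
  fixes P :: "(real ^ 'd::finite) measure"
  assumes P: "sets P = sets (sample_space \<X>)" and p: "is_marginal_pdf K P S p"
    and q: "is_pdf K S q"
  shows "(\<integral>\<^sup>+ x. ennreal (q (subvec x S)) / ennreal (p (subvec x S)) \<partial>P) \<le> 1"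
proof -
  have [measurable]: "p \<in> borel_measurable (subvec_space S)" "q \<in> borel_measurable (subvec_space S)"
    using p q is_pdf_measurable by (auto simp: is_marginal_pdf_def)
  have "(\<integral>\<^sup>+ x. ennreal (q (subvec x S)) / ennreal (p (subvec x S)) \<partial>P)
     = (\<integral>\<^sup>+ y. ennreal (p y) * (ennreal (q y) / ennreal (p y)) \<partial>ref_measure K S)"
    by (rule nn_integral_marginal_pdf[OF P p]) measurable
  also have "\<dots> \<le> 1" by (rule nn_integral_times_divide_is_pdf_le[OF q])
  finally show ?thesis .
qed

section \<open>Conditional PDFs and disintegration\<close>

text \<open>Points where the joint mass function is nonzero are atoms of the probability measure
  \<open>?Q\<close>, so there are only countably many. Passing to the full subvector is injective,
  so their preimage \<open>D\<close> is countable too, and it carries all of \<open>M\<close>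
  because \<open>p\<close> vanishes off \<open>E\<close>.\<close>

lemma Mass_countable_support:
  fixes M :: "(real ^ 'd::finite) measure"
  assumes prob: "prob_space M" and M_sets: "sets M = sets (sample_space \<X>)" and p: "is_marginal_pdf Mass M UNIV p"
  obtains D where "countable D" "D \<in> sets M" "AE x in M. x \<in> D"
proof -
  interpret prob_space M by fact
  define E where "E = {y \<in> space (subvec_space UNIV). p y \<noteq> 0}"
  define D where "D = {x \<in> space M. subvec x UNIV \<in> E}"
  have pdf: "is_pdf Mass UNIV p" using p by (simp add: is_marginal_pdf_def)
  note [measurable] = measurable_subvec[OF M_sets] is_pdf_measurable[OF pdf]
  let ?C = "count_space (UNIV :: ('d \<Rightarrow> real) set)"
  let ?Q = "density ?C (\<lambda>y. ennreal (p y))"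
  have int1: "(\<integral>\<^sup>+ y. ennreal (p y) \<partial>?C) = 1"
    using is_pdf_nn_integral[OF pdf] by (simp add: PiE_UNIV_domain)
  then interpret Q: prob_space ?Q
    by (intro prob_spaceI) (simp add: emeasure_density)
  have Q_singleton: "emeasure ?Q {y} = ennreal (p y)" for y
    by (subst emeasure_density) (auto simp: nn_integral_indicator_singleton)
  have "E \<subseteq> {y. measure ?Q {y} \<noteq> 0}"
    using is_pdf_nonneg[OF pdf] by (auto simp: E_def measure_def Q_singleton)
  then have "countable E" using Q.countable_support countable_subset by blast
  moreover have "inj_on (\<lambda>x. subvec x UNIV) D"
    by (auto simp: inj_on_def subvec_def vec_eq_iff fun_eq_iff)
  moreover have "(\<lambda>x. subvec x UNIV) ` D \<subseteq> E" by (auto simp: D_def)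
  ultimately have "countable D"
    using countable_subset countable_image_inj_on by metis
  moreover have E: "E \<in> sets (subvec_space UNIV)" unfolding E_def by measurable
  then have D: "D \<in> sets M" unfolding D_def by measurable
  moreover have "AE x in M. x \<in> D"
  proof -
    have "emeasure M D = (\<integral>\<^sup>+ y. ennreal (p y) * indicator E y \<partial>ref_measure Mass UNIV)"
      using p E by (simp add: D_def is_marginal_pdf_def)
    also have "\<dots> = (\<integral>\<^sup>+ y. ennreal (p y) \<partial>ref_measure Mass UNIV)"
      by (intro nn_integral_cong) (auto simp: E_def space_PiM indicator_def)
    also have "\<dots> = 1" using is_pdf_nn_integral[OF pdf] .
    finally show ?thesis using D by (subst AE_in_set_eq_1) (auto simp: emeasure_eq_measure)
  qed
  ultimately show ?thesis by (rule that)
qed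

text \<open>
  The counting measure on subvectors is not sigma-finite, so Fubini does not make the inner integral
  measurable for mass functions. There \<open>D\<close> is a countable set carrying \<open>M\<close>, off which the product is 0.
\<close>

lemma AE_measurable_integral_ref_measure:
  fixes M :: "(real ^ 'd::finite) measure"
  assumes prob: "prob_space M" and M_sets: "sets M = sets (sample_space \<X>)" and p: "is_marginal_pdf K M UNIV p"
  obtains D where "D \<in> sets M" "AE x in M. x \<in> D"
    "\<And>(A :: 'd set) B h. h \<in> borel_measurable (subvec_space A \<Otimes>\<^sub>M subvec_space B) \<Longrightarrow>
       (\<lambda>x. indicator D x * (\<integral>\<^sup>+ y. h (y, subvec x B) \<partial>ref_measure K A)) \<in> borel_measurable M"
proof (cases K)
  case Density
  note [measurable] = measurable_subvec[OF M_sets]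
  show ?thesis
  \<comment> \<open>A finite product of Lebesgue measures is sigma-finite, so nothing has to be cut
    away for densities.\<close>
  proof (rule that[of "space M"])
    fix A B :: "'d set" and h :: "('d \<Rightarrow> real) \<times> ('d \<Rightarrow> real) \<Rightarrow> ennreal"
    assume h: "h \<in> borel_measurable (subvec_space A \<Otimes>\<^sub>M subvec_space B)"
    interpret product_sigma_finite "\<lambda>_::'d. lborel :: real measure" by standard
    interpret S: sigma_finite_measure "\<Pi>\<^sub>M i\<in>A. (lborel :: real measure)"
      by (rule sigma_finite) simp
    have "(\<lambda>(x, y). h (y, subvec x B)) \<in> borel_measurable (M \<Otimes>\<^sub>M subvec_space A)"
      using h by measurable
    moreover have "sets (M \<Otimes>\<^sub>M subvec_space A) = sets (M \<Otimes>\<^sub>M (\<Pi>\<^sub>M i\<in>A. (lborel :: real measure)))"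
      by (intro sets_pair_measure_cong sets_PiM_cong) auto
    ultimately have "(\<lambda>(x, y). h (y, subvec x B)) \<in> borel_measurable (M \<Otimes>\<^sub>M (\<Pi>\<^sub>M i\<in>A. (lborel :: real measure)))"
      by (simp cong: measurable_cong_sets)
    then have "(\<lambda>x. \<integral>\<^sup>+ y. h (y, subvec x B) \<partial>ref_measure K A) \<in> borel_measurable M"
      unfolding Density ref_measure.simps by (rule S.borel_measurable_nn_integral)
    then show "(\<lambda>x. indicator (space M) x * (\<integral>\<^sup>+ y. h (y, subvec x B) \<partial>ref_measure K A)) \<in> borel_measurable M"
      by measurable
  qed auto
next
  case Mass
  obtain D where D: "countable D" "D \<in> sets M" "AE x in M. x \<in> D"
    using Mass_countable_support[OF prob M_sets p[unfolded Mass]] by blast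
  show ?thesis
  proof (rule that[OF D(2,3)])
    fix A B :: "'d set" and h :: "('d \<Rightarrow> real) \<times> ('d \<Rightarrow> real) \<Rightarrow> ennreal"
    \<comment> \<open>Points of \<open>D\<close> have measurable singletons. A function that differs
      from the constant 0 only on the countable set \<open>D\<close> is then measurable, whatever
      values the inner integral takes there.\<close>
    have "{x} \<in> sets M" if "x \<in> D" for x
    proof -
      have "x \<in> \<X>"
        using sets.sets_into_space[OF D(2)] sets_eq_imp_space_eq[OF M_sets] that
        by (auto simp: space_restrict_space)
      then show ?thesis unfolding M_sets by (auto simp: sets_restrict_space image_iff intro!: bexI[of _ "{x}"])
    qed
    then show "(\<lambda>x. indicator D x * (\<integral>\<^sup>+ y. h (y, subvec x B) \<partial>ref_measure K A)) \<in> borel_measurable M"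
      using D(1) by (intro measurable_discrete_difference[where f = "\<lambda>_. 0" and X = D, OF measurable_const]) auto
  qed
qed

text \<open>Drawing \<open>x\<close> from \<open>M\<close>, keeping its \<open>B\<close>-subvector
  and redrawing the \<open>A\<close>-subvector from \<open>c\<close> reproduces the joint law of the
  two subvectors. The definition of a conditional PDF says this on rectangles; these form an
  intersection-stable generator, so the two laws coincide, and integrating \<open>h\<close> against
  \<open>M \<bind> \<kappa>\<close> gives the iterated integral.\<close>

lemma nn_integral_conditional_pdf:
  fixes M :: "(real ^ 'd::finite) measure"
  assumes prob: "prob_space M" and M_sets: "sets M = sets (sample_space \<X>)" and p: "is_marginal_pdf K M UNIV p"
    and c: "is_conditional_pdf K M A B c"
    and h: "h \<in> borel_measurable (subvec_space A \<Otimes>\<^sub>M subvec_space B)"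
  shows "(\<integral>\<^sup>+ x. h (subvec x A, subvec x B) \<partial>M) =
    (\<integral>\<^sup>+ x. \<integral>\<^sup>+ y. ennreal (c y (subvec x B)) * h (y, subvec x B) \<partial>ref_measure K A \<partial>M)"
proof -
  interpret prob_space M by fact
  let ?R = "ref_measure K A" and ?N = "subvec_space A \<Otimes>\<^sub>M subvec_space B"
  note [measurable] = measurable_subvec[OF M_sets]
  have cm[measurable]: "(\<lambda>(y, z). c y z) \<in> borel_measurable ?N"
    using c by (simp add: is_conditional_pdf_def)
  have pdf: "is_pdf K A (\<lambda>y. c y (subvec x B))" for x
    using c subvec_in_space by (auto simp: is_conditional_pdf_def)
  have crm[measurable]: "(\<lambda>y. c y (subvec x B)) \<in> borel_measurable ?R" for x
    using is_pdf_measurable[OF pdf] by (rule measurable_ref_measureI)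
  have pair: "(\<lambda>y. (y, subvec x B)) \<in> ?R \<rightarrow>\<^sub>M ?N" for x
    by (intro measurable_Pair measurable_ident_ref_measure measurable_const subvec_in_space)
  obtain D where D: "D \<in> sets M" "AE x in M. x \<in> D"
    and Dm: "\<And>h. h \<in> borel_measurable ?N \<Longrightarrow>
       (\<lambda>x. indicator D x * (\<integral>\<^sup>+ y. h (y, subvec x B) \<partial>?R)) \<in> borel_measurable M"
    by (rule AE_measurable_integral_ref_measure[OF prob M_sets p]) (blast intro: that)
  \<comment> \<open>The redrawing kernel. Measurability in \<open>x\<close> is available only after
    multiplication by the indicator of \<open>D\<close>, so \<kappa> is the null measure off
    \<open>D\<close>. This makes it a subprobability kernel, and the change affects only a null set
    of \<open>M\<close>.\<close>
  define \<kappa> where "\<kappa> x = (if x \<in> D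
    then distr (density ?R (\<lambda>y. ennreal (c y (subvec x B)))) ?N (\<lambda>y. (y, subvec x B))
    else null_measure ?N)" for x
  have \<kappa>_sets: "sets (\<kappa> x) = sets ?N" for x by (simp add: \<kappa>_def)
  have \<kappa>_int: "(\<integral>\<^sup>+ u. f u \<partial>\<kappa> x)
      = indicator D x * (\<integral>\<^sup>+ y. ennreal (c y (subvec x B)) * f (y, subvec x B) \<partial>?R)"
    if f: "f \<in> borel_measurable ?N" for f x
  proof (cases "x \<in> D")
    case True
    have "(\<integral>\<^sup>+ u. f u \<partial>\<kappa> x)
        = (\<integral>\<^sup>+ y. f (y, subvec x B) \<partial>density ?R (\<lambda>y. ennreal (c y (subvec x B))))"
      using True f pair[of x] by (simp add: \<kappa>_def nn_integral_distr)
    also have "\<dots> = (\<integral>\<^sup>+ y. ennreal (c y (subvec x B)) * f (y, subvec x B) \<partial>?R)"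
      using measurable_compose[OF pair f] by (intro nn_integral_density) auto
    finally show ?thesis using True by simp
  next
    case False
    then show ?thesis by (simp add: \<kappa>_def)
  qed
  have \<kappa>_emeasure: "emeasure (\<kappa> x) E
      = indicator D x * (\<integral>\<^sup>+ y. ennreal (c y (subvec x B)) * indicator E (y, subvec x B) \<partial>?R)"
    if "E \<in> sets ?N" for E x
    using \<kappa>_int[of "indicator E" x] that nn_integral_indicator[of E "\<kappa> x"] by (simp add: \<kappa>_sets)
  have cmh: "(\<lambda>u. ennreal (case u of (y, z) \<Rightarrow> c y z) * f u) \<in> borel_measurable ?N"
    if "f \<in> borel_measurable ?N" for f :: "_ \<Rightarrow> ennreal"
    using that by measurable
  have \<kappa>: "\<kappa> \<in> M \<rightarrow>\<^sub>M subprob_algebra ?N"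
  proof (rule measurable_subprob_algebra)
    fix x assume "x \<in> space M"
    have "(\<integral>\<^sup>+ y. ennreal (c y (subvec x B)) * indicator (space ?N) (y, subvec x B) \<partial>?R)
        \<le> (\<integral>\<^sup>+ y. ennreal (c y (subvec x B)) \<partial>?R)"
      by (intro nn_integral_mono) (auto simp: indicator_def)
    then have "emeasure (\<kappa> x) (space (\<kappa> x)) \<le> 1"
      using is_pdf_nn_integral[OF pdf, of x]
      unfolding sets_eq_imp_space_eq[OF \<kappa>_sets] \<kappa>_emeasure[OF sets.top]
      by (auto simp: indicator_def)
    moreover have "space (\<kappa> x) \<noteq> {}"
      using subvec_in_space[of x A] subvec_in_space[of x B]
      unfolding sets_eq_imp_space_eq[OF \<kappa>_sets] space_pair_measure by blast
    ultimately show "subprob_space (\<kappa> x)" by (rule subprob_spaceI)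
  next
    fix E assume E: "E \<in> sets ?N"
    then show "(\<lambda>x. emeasure (\<kappa> x) E) \<in> borel_measurable M"
      using Dm[OF cmh[of "indicator E"]] by (simp add: \<kappa>_emeasure)
  qed (rule \<kappa>_sets)
  have AE_D: "(\<integral>\<^sup>+ x. indicator D x * f x \<partial>M) = (\<integral>\<^sup>+ x. f x \<partial>M)" for f :: "_ \<Rightarrow> ennreal"
    using D(2) by (intro nn_integral_cong_AE) auto
  let ?G = "{E \<times> F |E F. E \<in> sets (subvec_space A) \<and> F \<in> sets (subvec_space B)}"
  let ?d = "distr M ?N (\<lambda>x. (subvec x A, subvec x B))"
  have sub: "(\<lambda>x. (subvec x A, subvec x B)) \<in> M \<rightarrow>\<^sub>M ?N" by measurable
  have sets_bind: "sets (M \<bind> \<kappa>) = sets ?N"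
    using sets_bind[OF sets_kernel[OF \<kappa>] not_empty] .
  have "?d = M \<bind> \<kappa>"
  proof (rule measure_eqI_generator_eq[OF Int_stable_pair_measure_generator])
    show "?G \<subseteq> Pow (space ?N)"
      using sets.space_closed[of "subvec_space A"] sets.space_closed[of "subvec_space B"]
      by (auto simp: space_pair_measure)
    show "sets ?d = sigma_sets (space ?N) ?G"
      by (simp add: sets_pair_measure space_pair_measure)
    show "sets (M \<bind> \<kappa>) = sigma_sets (space ?N) ?G"
      unfolding sets_bind by (simp add: sets_pair_measure space_pair_measure)
    \<comment> \<open>The whole space is itself a rectangle of finite measure, so a constant
      sequence exhausts it.\<close>
    show "range (\<lambda>_::nat. space ?N) \<subseteq> ?G"
      by (auto simp: space_pair_measure)
    show "(\<Union>i::nat. space ?N) = space ?N" by simp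
    interpret d: prob_space ?d by (rule prob_space_distr[OF sub])
    show "emeasure ?d (space ?N) \<noteq> \<infinity>" for i :: nat by simp
    fix W assume "W \<in> ?G"
    then obtain E F where W: "W = E \<times> F" and E: "E \<in> sets (subvec_space A)" and F: "F \<in> sets (subvec_space B)"
      by auto
    have WN: "W \<in> sets ?N" unfolding W using E F by simp
    have "emeasure ?d W = emeasure M {x \<in> space M. subvec x A \<in> E \<and> subvec x B \<in> F}"
      using WN by (subst emeasure_distr[OF sub]) (auto simp: W intro!: arg_cong[where f = "emeasure M"])
    also have "\<dots> = (\<integral>\<^sup>+ x. indicator F (subvec x B) *
            (\<integral>\<^sup>+ y. ennreal (c y (subvec x B)) * indicator E y \<partial>?R) \<partial>M)"
      using c E F by (simp add: is_conditional_pdf_def)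
    also have "\<dots> = (\<integral>\<^sup>+ x. (\<integral>\<^sup>+ y. ennreal (c y (subvec x B)) * indicator W (y, subvec x B) \<partial>?R) \<partial>M)"
      by (intro nn_integral_cong) (auto simp: W indicator_def)
    also have "\<dots> = (\<integral>\<^sup>+ x. emeasure (\<kappa> x) W \<partial>M)"
      by (simp add: \<kappa>_emeasure[OF WN] AE_D)
    also have "\<dots> = emeasure (M \<bind> \<kappa>) W"
      using emeasure_bind[OF not_empty \<kappa> WN] by simp
    finally show "emeasure ?d W = emeasure (M \<bind> \<kappa>) W" .
  qed
  then have "(\<integral>\<^sup>+ x. h (subvec x A, subvec x B) \<partial>M) = (\<integral>\<^sup>+ u. h u \<partial>(M \<bind> \<kappa>))"
    by (subst nn_integral_distr[OF sub, symmetric]) (simp_all add: h measurable_cong_sets[OF sets_bind refl])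
  also have "\<dots> = (\<integral>\<^sup>+ x. \<integral>\<^sup>+ u. h u \<partial>\<kappa> x \<partial>M)"
    by (rule nn_integral_bind[OF h \<kappa>])
  also have "\<dots> = (\<integral>\<^sup>+ x. \<integral>\<^sup>+ y. ennreal (c y (subvec x B)) * h (y, subvec x B) \<partial>?R \<partial>M)"
    by (simp add: \<kappa>_int[OF h] AE_D)
  finally show ?thesis .
qed

text \<open>For each value of the conditioning subvector the inner integral is that of
  \<open>c\<close> times \<open>c' / c\<close>, hence at most 1. Here \<open>c'\<close> belongs to
  another parameter than the data, and a null set of that parameter may be charged by
  \<open>M\<close>; this is why \<open>c'\<close> is a PDF for every \<open>z\<close>, not merely
  for almost every one.\<close>

lemma nn_integral_conditional_ratio_le:
  fixes M :: "(real ^ 'd::finite) measure"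
  assumes prob: "prob_space M" and M_sets: "sets M = sets (sample_space \<X>)" and p: "is_marginal_pdf K M UNIV p"
    and c: "is_conditional_pdf K M A B c"
    and cm': "(\<lambda>(y, z). c' y z) \<in> borel_measurable (subvec_space A \<Otimes>\<^sub>M subvec_space B)"
    and c': "\<And>z. z \<in> space (subvec_space B) \<Longrightarrow> is_pdf K A (\<lambda>y. c' y z)"
  shows "(\<integral>\<^sup>+ x. ennreal (c' (subvec x A) (subvec x B)) / ennreal (c (subvec x A) (subvec x B)) \<partial>M) \<le> 1"
proof -
  interpret prob_space M by fact
  have cm: "(\<lambda>(y, z). c y z) \<in> borel_measurable (subvec_space A \<Otimes>\<^sub>M subvec_space B)"
    using c by (simp add: is_conditional_pdf_def)
  define h where "h = (\<lambda>(y, z). ennreal (c' y z) / ennreal (c y z))"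
  have h: "h \<in> borel_measurable (subvec_space A \<Otimes>\<^sub>M subvec_space B)"
    unfolding h_def using cm cm' by measurable
  have "(\<integral>\<^sup>+ x. h (subvec x A, subvec x B) \<partial>M) =
    (\<integral>\<^sup>+ x. \<integral>\<^sup>+ y. ennreal (c y (subvec x B)) * h (y, subvec x B) \<partial>ref_measure K A \<partial>M)"
    by (rule nn_integral_conditional_pdf[OF prob M_sets p c h])
  also have "\<dots> \<le> (\<integral>\<^sup>+ x. 1 \<partial>M)"
    unfolding h_def prod.case
    by (intro nn_integral_mono nn_integral_times_divide_is_pdf_le c' subvec_in_space)
  also have "\<dots> = 1" by (simp add: emeasure_space_1)
  finally show ?thesis by (simp add: h_def)
qed

section \<open>Composite PDFs and the mean of their ratio\<close>

lemma comp_pdf_nonneg: "0 \<le> comp_pdf a b p c \<theta> x"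
  unfolding comp_pdf_def by (intro mult_nonneg_nonneg prod_nonneg rpow_nonneg)

lemma borel_measurable_rpow:
  assumes "f \<in> borel_measurable M"
  shows "(\<lambda>x. rpow (f x) w) \<in> borel_measurable M"
  using assms by (cases "w = 0") (auto simp: rpow_def)

lemma borel_measurable_comp_pdf:
  fixes M :: "(real ^ 'd::finite) measure"
  assumes M_sets: "sets M = sets (sample_space \<X>)"
    and p: "\<And>S. S \<in> index_sets \<Longrightarrow> is_pdf K S (p \<theta> S)"
    and c: "\<And>A B. (A, B) \<in> index_pairs \<Longrightarrow>
      (\<lambda>(y, z). c \<theta> (A, B) y z) \<in> borel_measurable (subvec_space A \<Otimes>\<^sub>M subvec_space B)"
  shows "comp_pdf a b p c \<theta> \<in> borel_measurable M"
proof -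
  note [measurable] = measurable_subvec[OF M_sets]
  have "(\<lambda>x. p \<theta> S (subvec x S)) \<in> borel_measurable M" if "S \<in> index_sets" for S
    by (rule measurable_compose[OF measurable_subvec[OF M_sets] is_pdf_measurable[OF p[OF that]]])
  moreover have "(\<lambda>x. c \<theta> T (subvec x (fst T)) (subvec x (snd T))) \<in> borel_measurable M"
    if "T \<in> index_pairs" for T
  proof -
    have "(\<lambda>x. (subvec x (fst T), subvec x (snd T))) \<in> M \<rightarrow>\<^sub>M subvec_space (fst T) \<Otimes>\<^sub>M subvec_space (snd T)"
      by measurable
    from measurable_compose[OF this c[of "fst T" "snd T"]] that show ?thesis by simp
  qed
  ultimately show ?thesis
    unfolding comp_pdf_def
    by (intro borel_measurable_times borel_measurable_prod borel_measurable_rpow)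
qed

text \<open>Marginal and conditional factors become one family over the disjoint sum of the two
  index sets. Division by \<open>total_weight\<close> makes the exponents sum to 1 there, so AM-GM
  applies once to the whole product.\<close>

lemma comp_pdf_ratio_le:
  assumes a: "\<And>S. S \<in> index_sets \<Longrightarrow> 0 \<le> a S" and b: "\<And>T. T \<in> index_pairs \<Longrightarrow> 0 \<le> b T"
    and pos: "0 < total_weight a b"
    and p: "\<And>\<eta> S. \<eta> \<in> {\<theta>, \<theta>'} \<Longrightarrow> S \<in> index_sets \<Longrightarrow> 0 \<le> p \<eta> S (subvec x S)"
    and c: "\<And>\<eta> T. \<eta> \<in> {\<theta>, \<theta>'} \<Longrightarrow> T \<in> index_pairs \<Longrightarrow> 0 \<le> c \<eta> T (subvec x (fst T)) (subvec x (snd T))"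
  shows "ennreal (comp_pdf a b p c \<theta> x) / ennreal (comp_pdf a b p c \<theta>' x) \<le>
    (\<Sum>S\<in>index_sets. ennreal (a S / total_weight a b) *
       (ennreal (p \<theta> S (subvec x S)) / ennreal (p \<theta>' S (subvec x S)))) +
    (\<Sum>T\<in>index_pairs. ennreal (b T / total_weight a b) *
       (ennreal (c \<theta> T (subvec x (fst T)) (subvec x (snd T))) /
        ennreal (c \<theta>' T (subvec x (fst T)) (subvec x (snd T)))))"
proof -
  let ?I = "index_sets <+> index_pairs :: ('a set + 'a set \<times> 'a set) set"
  define w where "w = case_sum (\<lambda>S. a S / total_weight a b) (\<lambda>T. b T / total_weight a b)"
  define f where "f \<eta> = case_sum (\<lambda>S. p \<eta> S (subvec x S))
    (\<lambda>T. c \<eta> T (subvec x (fst T)) (subvec x (snd T)))" for \<eta>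
  have comp: "comp_pdf a b p c \<eta> x = (\<Prod>i\<in>?I. rpow (f \<eta> i) (w i))" for \<eta>
    by (simp add: prod.Plus comp_pdf_def f_def w_def)
  have "(\<Sum>i\<in>?I. w i) = 1"
    using pos by (simp add: sum.Plus w_def total_weight_def flip: sum_divide_distrib add_divide_distrib)
  then have "ennreal (comp_pdf a b p c \<theta> x) / ennreal (comp_pdf a b p c \<theta>' x)
      \<le> (\<Sum>i\<in>?I. ennreal (w i) * (ennreal (f \<theta> i) / ennreal (f \<theta>' i)))"
    unfolding comp using a b p c pos
    by (intro ennreal_prod_rpow_divide_le) (auto simp: w_def f_def)
  then show ?thesis by (simp add: sum.Plus w_def f_def)
qed

text \<open>A composite PDF is in general not a density, so its denominator cannot be cancelled
  against the distribution of the data. The AM-GM bound is linear in the component ratios and each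
  component does cancel; the normalised weights then add up to 1. The data come from \<theta>',
  while \<theta> is any fixed competitor.\<close>

lemma nn_integral_comp_pdf_ratio_le:
  fixes M :: "(real ^ 'd::finite) measure"
  assumes prob: "prob_space M" and M_sets: "sets M = sets (sample_space \<X>)"
    and a: "\<And>S. S \<in> index_sets \<Longrightarrow> 0 \<le> a S" and b: "\<And>T. T \<in> index_pairs \<Longrightarrow> 0 \<le> b T"
    and pos: "0 < total_weight a b"
    and p: "\<And>S. S \<in> index_sets \<Longrightarrow> is_marginal_pdf K M S (p \<theta>' S)"
    and c: "\<And>A B. (A, B) \<in> index_pairs \<Longrightarrow> is_conditional_pdf K M A B (c \<theta>' (A, B))"
    and p': "\<And>S. S \<in> index_sets \<Longrightarrow> is_pdf K S (p \<theta> S)"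
    and cm': "\<And>A B. (A, B) \<in> index_pairs \<Longrightarrow>
      (\<lambda>(y, z). c \<theta> (A, B) y z) \<in> borel_measurable (subvec_space A \<Otimes>\<^sub>M subvec_space B)"
    and c': "\<And>A B z. (A, B) \<in> index_pairs \<Longrightarrow> z \<in> space (subvec_space B) \<Longrightarrow>
      is_pdf K A (\<lambda>y. c \<theta> (A, B) y z)"
  shows "(\<integral>\<^sup>+ x. ennreal (comp_pdf a b p c \<theta> x) / ennreal (comp_pdf a b p c \<theta>' x) \<partial>M) \<le> 1"
proof -
  let ?w = "\<lambda>v. ennreal (v / total_weight a b)"
  let ?p = "\<lambda>S x. ennreal (p \<theta> S (subvec x S)) / ennreal (p \<theta>' S (subvec x S))"
  let ?c = "\<lambda>T x. ennreal (c \<theta> T (subvec x (fst T)) (subvec x (snd T))) /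
      ennreal (c \<theta>' T (subvec x (fst T)) (subvec x (snd T)))"
  have pdf: "is_pdf K S (p \<theta>' S)" if "S \<in> index_sets" for S
    using p[OF that] by (simp add: is_marginal_pdf_def)
  have cm: "(\<lambda>(y, z). c \<theta>' (A, B) y z) \<in> borel_measurable (subvec_space A \<Otimes>\<^sub>M subvec_space B)"
    and cpdf: "\<And>z. z \<in> space (subvec_space B) \<Longrightarrow> is_pdf K A (\<lambda>y. c \<theta>' (A, B) y z)"
    if "(A, B) \<in> index_pairs" for A B
    using c[OF that] by (auto simp: is_conditional_pdf_def)
  have pm: "?p S \<in> borel_measurable M" if S: "S \<in> index_sets" for S
  proof -
    note [measurable] = measurable_subvec[OF M_sets] is_pdf_measurable[OF pdf[OF S]] is_pdf_measurable[OF p'[OF S]]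
    show ?thesis by measurable
  qed
  have cm: "?c T \<in> borel_measurable M" if T: "T \<in> index_pairs" for T
  proof -
    obtain A B where AB: "T = (A, B)" by (cases T)
    note [measurable] = measurable_subvec[OF M_sets] cm[OF T[unfolded AB]] cm'[OF T[unfolded AB]]
    show ?thesis unfolding AB fst_conv snd_conv by measurable
  qed
  \<comment> \<open>The full coordinate set is among the index sets, which supplies the joint PDF;
    the countable support in the discrete case is read off from it.\<close>
  have univ: "is_marginal_pdf K M UNIV (p \<theta>' UNIV)"
    by (rule p) (simp add: index_sets_def)
  have "ennreal (comp_pdf a b p c \<theta> x) / ennreal (comp_pdf a b p c \<theta>' x)
      \<le> (\<Sum>S\<in>index_sets. ?w (a S) * ?p S x) + (\<Sum>T\<in>index_pairs. ?w (b T) * ?c T x)" for x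
  proof (rule comp_pdf_ratio_le[OF a b pos])
    fix \<eta> and S :: "'d set" assume "\<eta> \<in> {\<theta>, \<theta>'}" "S \<in> index_sets"
    then show "0 \<le> p \<eta> S (subvec x S)"
      using is_pdf_nonneg[OF pdf] is_pdf_nonneg[OF p'] subvec_in_space by blast
  next
    fix \<eta> T assume "\<eta> \<in> {\<theta>, \<theta>'}" and T: "T \<in> (index_pairs :: ('d set \<times> 'd set) set)"
    then show "0 \<le> c \<eta> T (subvec x (fst T)) (subvec x (snd T))"
      using is_pdf_nonneg[OF cpdf[of "fst T" "snd T", OF _ subvec_in_space] subvec_in_space]
        is_pdf_nonneg[OF c'[of "fst T" "snd T", OF _ subvec_in_space] subvec_in_space] by auto
  qed
  then have "(\<integral>\<^sup>+ x. ennreal (comp_pdf a b p c \<theta> x) / ennreal (comp_pdf a b p c \<theta>' x) \<partial>M)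
      \<le> (\<integral>\<^sup>+ x. (\<Sum>S\<in>index_sets. ?w (a S) * ?p S x) + (\<Sum>T\<in>index_pairs. ?w (b T) * ?c T x) \<partial>M)"
    by (rule nn_integral_mono)
  also have "\<dots> = (\<Sum>S\<in>index_sets. ?w (a S) * (\<integral>\<^sup>+ x. ?p S x \<partial>M)) +
      (\<Sum>T\<in>index_pairs. ?w (b T) * (\<integral>\<^sup>+ x. ?c T x \<partial>M))"
    using pm cm by (simp add: nn_integral_add nn_integral_sum nn_integral_cmult)
  also have "\<dots> \<le> (\<Sum>S\<in>index_sets. ?w (a S) * 1) + (\<Sum>T\<in>index_pairs. ?w (b T) * 1)"
  proof (intro add_mono sum_mono mult_left_mono)
    fix S :: "'d set" assume "S \<in> index_sets"
    then show "(\<integral>\<^sup>+ x. ?p S x \<partial>M) \<le> 1"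
      by (intro nn_integral_marginal_ratio_le[OF M_sets p p'])
  next
    fix T :: "'d set \<times> 'd set" assume T: "T \<in> index_pairs"
    obtain A B where AB: "T = (A, B)" by (cases T)
    show "(\<integral>\<^sup>+ x. ?c T x \<partial>M) \<le> 1"
      using T unfolding AB fst_conv snd_conv
      by (intro nn_integral_conditional_ratio_le[OF prob M_sets univ] c cm' c')
  qed auto
  also have "\<dots> = ennreal ((\<Sum>S\<in>index_sets. a S / total_weight a b) + (\<Sum>T\<in>index_pairs. b T / total_weight a b))"
    using a b pos by (simp add: ennreal_plus sum_nonneg)
  also have "\<dots> = 1"
    using pos by (simp add: total_weight_def flip: sum_divide_distrib add_divide_distrib)
  finally show ?thesis .
qed

section \<open>Product samples, the split statistic and coverage\<close>

text \<open>Once the ratio is bounded by a product of ratios in distinct coordinates, its integral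
  over the product measure factorises, and every factor is at most 1.\<close>

lemma nn_integral_PiM_prod_ratio_le:
  fixes f g :: "'x \<Rightarrow> real"
  assumes M: "prob_space M" and J: "finite J"
    and [measurable]: "f \<in> borel_measurable M" "g \<in> borel_measurable M"
    and nonneg: "\<And>x. 0 \<le> f x" "\<And>x. 0 \<le> g x"
    and le: "(\<integral>\<^sup>+ x. ennreal (f x) / ennreal (g x) \<partial>M) \<le> 1"
  shows "(\<integral>\<^sup>+ x. ennreal (\<Prod>j\<in>J. f (x j)) / ennreal (\<Prod>j\<in>J. g (x j)) \<partial>(\<Pi>\<^sub>M j\<in>J. M)) \<le> 1"
proof -
  interpret prob_space M by fact
  interpret product_sigma_finite "\<lambda>_. M" ..
  have "(\<integral>\<^sup>+ x. ennreal (\<Prod>j\<in>J. f (x j)) / ennreal (\<Prod>j\<in>J. g (x j)) \<partial>(\<Pi>\<^sub>M j\<in>J. M))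
      \<le> (\<integral>\<^sup>+ x. (\<Prod>j\<in>J. ennreal (f (x j)) / ennreal (g (x j))) \<partial>(\<Pi>\<^sub>M j\<in>J. M))"
    using J nonneg by (intro nn_integral_mono ennreal_prod_divide_le) auto
  also have "\<dots> = (\<Prod>j\<in>J. \<integral>\<^sup>+ x. ennreal (f x) / ennreal (g x) \<partial>M)"
    using J by (intro product_nn_integral_prod) auto
  also have "\<dots> \<le> 1"
    using le by (simp add: power_le_one)
  finally show ?thesis .
qed

text \<open>Undoing the re-indexing places the halves on disjoint blocks of the full sample, the
  form in which \<open>merge\<close> can separate them.\<close>

lemma comp_lik_half_sample:
  "comp_lik a b p c n \<theta> (half_sample n k xs) = (\<Prod>j\<in>{k * n + 1..k * n + n}. comp_pdf a b p c \<theta> (xs j))"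
  unfolding comp_lik_def half_sample_def
  by (rule prod.reindex_bij_witness[where i = "\<lambda>j. j - k * n" and j = "\<lambda>i. k * n + i"]) auto

lemma nn_integral_split_stat_le:
  fixes M :: "(real ^ 'd::finite) measure"
  assumes M: "prob_space M" and k: "k \<in> {0, 1}"
    and stat: "split_stat a b p c n est k \<theta>' \<in> borel_measurable (\<Pi>\<^sub>M i\<in>{1..2 * n}. M)"
    and est: "\<And>x. x \<in> space (\<Pi>\<^sub>M i\<in>{1..n}. M) \<Longrightarrow> est (1 - k) x \<in> \<Theta>"
    and comp: "\<And>\<theta>. \<theta> \<in> \<Theta> \<Longrightarrow> comp_pdf a b p c \<theta> \<in> borel_measurable M" and \<theta>': "\<theta>' \<in> \<Theta>"
    and le: "\<And>\<theta>. \<theta> \<in> \<Theta> \<Longrightarrow>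
      (\<integral>\<^sup>+ x. ennreal (comp_pdf a b p c \<theta> x) / ennreal (comp_pdf a b p c \<theta>' x) \<partial>M) \<le> 1"
  shows "(\<integral>\<^sup>+ x. split_stat a b p c n est k \<theta>' x \<partial>(\<Pi>\<^sub>M i\<in>{1..2 * n}. M)) \<le> 1"
proof -
  interpret prob_space M by fact
  interpret product_sigma_finite "\<lambda>_. M" ..
  \<comment> \<open>\<open>I\<close> is the block that the estimator sees, \<open>J\<close> the
    block on which the likelihoods are evaluated.\<close>
  define I where "I = {(1 - k) * n + 1..(1 - k) * n + n}"
  define J where "J = {k * n + 1..k * n + n}"
  have IJ: "I \<inter> J = {}" "finite I" "finite J" and un: "{1..2 * n} = I \<union> J"
    using k by (auto simp: I_def J_def)
  interpret I: prob_space "\<Pi>\<^sub>M i\<in>I. M" by (intro prob_space_PiM M)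
  let ?m = "\<lambda>x y. merge I J (x, y)"
  have "(\<integral>\<^sup>+ x. split_stat a b p c n est k \<theta>' x \<partial>(\<Pi>\<^sub>M i\<in>{1..2 * n}. M))
      = (\<integral>\<^sup>+ x. \<integral>\<^sup>+ y. split_stat a b p c n est k \<theta>' (?m x y) \<partial>(\<Pi>\<^sub>M i\<in>J. M) \<partial>(\<Pi>\<^sub>M i\<in>I. M))"
    using stat unfolding un by (intro product_nn_integral_fold IJ)
  also have "\<dots> \<le> (\<integral>\<^sup>+ x. 1 \<partial>(\<Pi>\<^sub>M i\<in>I. M))"
  proof (rule nn_integral_mono)
    fix x assume x: "x \<in> space (\<Pi>\<^sub>M i\<in>I. M)"
    define \<theta> where "\<theta> = est (1 - k) (half_sample n (1 - k) x)"
    have "half_sample n (1 - k) x \<in> space (\<Pi>\<^sub>M i\<in>{1..n}. M)"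
      using x unfolding space_PiM half_sample_def I_def by (force simp: PiE_iff)
    then have \<theta>: "\<theta> \<in> \<Theta>" unfolding \<theta>_def by (rule est)
    have "half_sample n (1 - k) (?m x y) = half_sample n (1 - k) x" for y
      by (auto simp: half_sample_def merge_def I_def fun_eq_iff)
    moreover have "(\<Prod>j\<in>J. comp_pdf a b p c \<eta> (?m x y j)) = (\<Prod>j\<in>J. comp_pdf a b p c \<eta> (y j))" for \<eta> y
      using IJ(1) by (intro prod.cong) (auto simp: merge_def)
    ultimately have "split_stat a b p c n est k \<theta>' (?m x y) =
        ennreal (\<Prod>j\<in>J. comp_pdf a b p c \<theta> (y j)) / ennreal (\<Prod>j\<in>J. comp_pdf a b p c \<theta>' (y j))" for y
      unfolding split_stat_def comp_lik_half_sample J_def[symmetric] \<theta>_def by simp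
    then show "(\<integral>\<^sup>+ y. split_stat a b p c n est k \<theta>' (?m x y) \<partial>(\<Pi>\<^sub>M i\<in>J. M)) \<le> 1"
      using nn_integral_PiM_prod_ratio_le[OF M IJ(3) comp[OF \<theta>] comp[OF \<theta>'] comp_pdf_nonneg comp_pdf_nonneg le[OF \<theta>]]
      by simp
  qed
  also have "\<dots> = 1" by (simp add: I.emeasure_space_1)
  finally show ?thesis .
qed

text \<open>The complementary event has probability at most \<alpha> by Markov's inequality. Since
  \<open>f\<close> is extended-valued, points where a ratio is infinite are simply counted as
  failures of coverage.\<close>

lemma (in prob_space) prob_le_inverse_ge:
  assumes [measurable]: "f \<in> borel_measurable M" and le: "(\<integral>\<^sup>+ x. f x \<partial>M) \<le> 1" and \<alpha>: "0 < \<alpha>"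
  shows "1 - \<alpha> \<le> prob {x \<in> space M. f x \<le> ennreal (1 / \<alpha>)}"
proof -
  have "ennreal (1 / \<alpha>) < f x \<Longrightarrow> 1 \<le> ennreal \<alpha> * f x" for x
    using mult_left_mono[of "ennreal (1 / \<alpha>)" "f x" "ennreal \<alpha>"] \<alpha>
    by (simp add: less_imp_le flip: ennreal_mult)
  then have "emeasure M {x \<in> space M. \<not> f x \<le> ennreal (1 / \<alpha>)}
      \<le> emeasure M {x \<in> space M. 1 \<le> ennreal \<alpha> * f x}"
    by (intro emeasure_mono) auto
  also have "\<dots> \<le> ennreal \<alpha> * (\<integral>\<^sup>+ x. f x * indicator (space M) x \<partial>M)"
    by (intro nn_integral_Markov_inequality) auto
  also have "\<dots> = ennreal \<alpha> * (\<integral>\<^sup>+ x. f x \<partial>M)"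
    by (intro arg_cong2[where f = "(*)"] refl nn_integral_cong) auto
  also have "\<dots> \<le> ennreal \<alpha>"
    using mult_left_mono[OF le, of "ennreal \<alpha>"] by simp
  finally have "prob {x \<in> space M. \<not> f x \<le> ennreal (1 / \<alpha>)} \<le> \<alpha>"
    using \<alpha> by (simp add: emeasure_eq_measure)
  then show ?thesis by (subst (asm) prob_neg) auto
qed

theorem proposition1:
  fixes K :: pdf_kind
    and \<X> :: "(real ^ 'd::finite) set"
    and \<Theta> :: "(real ^ 'q::finite) set"
    and P :: "real ^ 'q \<Rightarrow> (real ^ 'd) measure"
    and p :: "real ^ 'q \<Rightarrow> 'd set \<Rightarrow> ('d \<Rightarrow> real) \<Rightarrow> real"
    and c :: "real ^ 'q \<Rightarrow> 'd set \<times> 'd set \<Rightarrow> ('d \<Rightarrow> real) \<Rightarrow> ('d \<Rightarrow> real) \<Rightarrow> real"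
    and a :: "'d set \<Rightarrow> real"
    and b :: "'d set \<times> 'd set \<Rightarrow> real"
    and n :: nat
    and est :: "nat \<Rightarrow> (nat \<Rightarrow> real ^ 'd) \<Rightarrow> real ^ 'q"
    and \<alpha> :: real
    and \<theta>s :: "real ^ 'q"
    and M :: "'w measure"
    and X :: "nat \<Rightarrow> 'w \<Rightarrow> real ^ 'd"
  assumes P_prob: "\<And>\<theta>. \<theta> \<in> \<Theta> \<Longrightarrow> prob_space (P \<theta>)"
    and P_sets: "\<And>\<theta>. \<theta> \<in> \<Theta> \<Longrightarrow> sets (P \<theta>) = sets (sample_space \<X>)"
    and marginal: "\<And>\<theta> S. \<theta> \<in> \<Theta> \<Longrightarrow> S \<in> index_sets \<Longrightarrow> is_marginal_pdf K (P \<theta>) S (p \<theta> S)"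
    and conditional: "\<And>\<theta> A B. \<theta> \<in> \<Theta> \<Longrightarrow> (A, B) \<in> index_pairs \<Longrightarrow>
          is_conditional_pdf K (P \<theta>) A B (c \<theta> (A, B))"
    and a_nonneg: "\<And>S. S \<in> index_sets \<Longrightarrow> 0 \<le> a S"
    and b_nonneg: "\<And>T. T \<in> index_pairs \<Longrightarrow> 0 \<le> b T"
    and weight_pos: "0 < total_weight a b"
    and level: "0 < \<alpha>" "\<alpha> < 1"
    and true_param: "\<theta>s \<in> \<Theta>"
    and M_prob: "prob_space M"
    and indep: "prob_space.indep_vars M (\<lambda>_. sample_space \<X>) X {1..2 * n}"
    and ident: "\<And>i. i \<in> {1..2 * n} \<Longrightarrow> distr M (sample_space \<X>) (X i) = P \<theta>s"
    and estimator: "\<And>k. k \<in> {0, 1} \<Longrightarrow>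
          est k \<in> measurable (\<Pi>\<^sub>M i\<in>{1..n}. sample_space \<X>) (restrict_space borel \<Theta>)"
    and statistic: "\<And>k. k \<in> {0, 1} \<Longrightarrow>
          split_stat a b p c n est k \<theta>s \<in> borel_measurable (\<Pi>\<^sub>M i\<in>{1..2 * n}. sample_space \<X>)"
  shows "measure M {\<omega>\<in>space M.
             \<theta>s \<in> split_conf_set a b p c n est \<Theta> \<alpha> (\<lambda>i\<in>{1..2 * n}. X i \<omega>)} \<ge> 1 - \<alpha> \<and>
         measure M {\<omega>\<in>space M.
             \<theta>s \<in> swapped_conf_set a b p c n est \<Theta> \<alpha> (\<lambda>i\<in>{1..2 * n}. X i \<omega>)} \<ge> 1 - \<alpha>"
proof -
  interpret prob_space M by (rule M_prob)
  interpret P: prob_space "P \<theta>s" by (rule P_prob[OF true_param])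
  let ?I = "{1..2 * n}"
  let ?X = "\<lambda>\<omega>. \<lambda>i\<in>?I. X i \<omega>"
  let ?stat = "\<lambda>k \<omega>. split_stat a b p c n est k \<theta>s (?X \<omega>)"
  have pdf: "is_pdf K S (p \<theta> S)" if "\<theta> \<in> \<Theta>" "S \<in> index_sets" for \<theta> S
    using marginal[OF that] by (simp add: is_marginal_pdf_def)
  have cm: "(\<lambda>(y, z). c \<theta> (A, B) y z) \<in> borel_measurable (subvec_space A \<Otimes>\<^sub>M subvec_space B)"
    and cpdf: "\<And>z. z \<in> space (subvec_space B) \<Longrightarrow> is_pdf K A (\<lambda>y. c \<theta> (A, B) y z)"
    if "\<theta> \<in> \<Theta>" "(A, B) \<in> index_pairs" for \<theta> A B
    using conditional[OF that] by (auto simp: is_conditional_pdf_def)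
  note sets_P = P_sets[OF true_param]
  have sets_PiM: "sets (\<Pi>\<^sub>M i\<in>J. P \<theta>s) = sets (\<Pi>\<^sub>M i\<in>J. sample_space \<X>)" for J :: "nat set"
    by (intro sets_PiM_cong refl sets_P)
  have X: "X i \<in> M \<rightarrow>\<^sub>M sample_space \<X>" if "i \<in> ?I" for i
    using indep that by (auto simp: indep_vars_def)
  have XI: "?X \<in> M \<rightarrow>\<^sub>M (\<Pi>\<^sub>M i\<in>?I. sample_space \<X>)"
    by (rule measurable_restrict[OF X])
  have stat_meas: "?stat k \<in> borel_measurable M" if "k \<in> {0, 1}" for k
    by (rule measurable_compose[OF XI statistic[OF that]])
  have stat_le: "(\<integral>\<^sup>+ \<omega>. ?stat k \<omega> \<partial>M) \<le> 1" if k: "k \<in> {0, 1}" for k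
  \<comment> \<open>Independence is turned into a product law only for a nonempty index set. For an
    empty sample both likelihoods are empty products and the statistic is constantly 1.\<close>
  proof (cases "n = 0")
    case True
    then show ?thesis by (simp add: split_stat_def comp_lik_def emeasure_space_1)
  next
    case False
    then have "?I \<noteq> {}" by simp
    with indep_vars_iff_distr_eq_PiM'[of ?I X "\<lambda>_. sample_space \<X>"] X indep
    have "distr M (\<Pi>\<^sub>M i\<in>?I. sample_space \<X>) ?X = (\<Pi>\<^sub>M i\<in>?I. distr M (sample_space \<X>) (X i))"
      by blast
    also have "\<dots> = (\<Pi>\<^sub>M i\<in>?I. P \<theta>s)"
      by (intro PiM_cong refl ident)
    finally have distr: "distr M (\<Pi>\<^sub>M i\<in>?I. sample_space \<X>) ?X = (\<Pi>\<^sub>M i\<in>?I. P \<theta>s)" .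
    have "(\<integral>\<^sup>+ \<omega>. ?stat k \<omega> \<partial>M) = (\<integral>\<^sup>+ x. split_stat a b p c n est k \<theta>s x \<partial>(\<Pi>\<^sub>M i\<in>?I. P \<theta>s))"
      unfolding distr[symmetric] by (rule nn_integral_distr[OF XI, symmetric]) (use statistic[OF k] in simp)
    also have "\<dots> \<le> 1"
    proof (rule nn_integral_split_stat_le[where \<Theta> = \<Theta>])
      show "split_stat a b p c n est k \<theta>s \<in> borel_measurable (\<Pi>\<^sub>M i\<in>?I. P \<theta>s)"
        using statistic[OF k] by (simp add: measurable_cong_sets[OF sets_PiM refl])
      have "1 - k \<in> {0, 1}" by auto
      from measurable_space[OF estimator[OF this]]
      show "est (1 - k) x \<in> \<Theta>" if "x \<in> space (\<Pi>\<^sub>M i\<in>{1..n}. P \<theta>s)" for x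
        using that unfolding sets_eq_imp_space_eq[OF sets_PiM] by (auto simp: space_restrict_space)
      show "comp_pdf a b p c \<theta> \<in> borel_measurable (P \<theta>s)" if "\<theta> \<in> \<Theta>" for \<theta>
        by (rule borel_measurable_comp_pdf[where p = p and c = c and \<theta> = \<theta>, OF sets_P pdf[OF that] cm[OF that]])
      show "(\<integral>\<^sup>+ x. ennreal (comp_pdf a b p c \<theta> x) / ennreal (comp_pdf a b p c \<theta>s x) \<partial>P \<theta>s) \<le> 1"
        if "\<theta> \<in> \<Theta>" for \<theta>
        by (rule nn_integral_comp_pdf_ratio_le[where p = p and c = c and \<theta> = \<theta> and \<theta>' = \<theta>s,
              OF P.prob_space_axioms sets_P a_nonneg b_nonneg weight_pos
              marginal[OF true_param] conditional[OF true_param] pdf[OF that] cm[OF that] cpdf[OF that]])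
    qed (fact P.prob_space_axioms k true_param)+
    finally show ?thesis .
  qed
  have [measurable]: "?stat 0 \<in> borel_measurable M" "?stat 1 \<in> borel_measurable M"
    using stat_meas by blast+
  \<comment> \<open>The two statistics share all the data and are in general dependent; linearity of
    the integral is enough to bound the mean of their average.\<close>
  have "(\<integral>\<^sup>+ \<omega>. (?stat 0 \<omega> + ?stat 1 \<omega>) / 2 \<partial>M)
      = ((\<integral>\<^sup>+ \<omega>. ?stat 0 \<omega> \<partial>M) + (\<integral>\<^sup>+ \<omega>. ?stat 1 \<omega> \<partial>M)) / 2"
    by (simp add: nn_integral_divide nn_integral_add del: One_nat_def)
  also have "\<dots> \<le> (1 + 1) / 2"
    by (intro divide_right_mono_ennreal add_mono stat_le) auto
  finally have swapped_le: "(\<integral>\<^sup>+ \<omega>. (?stat 0 \<omega> + ?stat 1 \<omega>) / 2 \<partial>M) \<le> 1"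
    by simp
  have swapped_meas: "(\<lambda>\<omega>. (?stat 0 \<omega> + ?stat 1 \<omega>) / 2) \<in> borel_measurable M"
    by measurable
  show ?thesis
    using prob_le_inverse_ge[OF stat_meas stat_le level(1), of 0]
      prob_le_inverse_ge[OF swapped_meas swapped_le level(1)] true_param
    by (simp add: split_conf_set_def swapped_conf_set_def swapped_stat_def)
qed

end
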